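(* Let $X$ and $Y$ be two Möbius invariant spaces of analytic functions in $\mathbb{D}$ equipped with the seminorms $\rho_X$ and $\rho_Y$, respectively, where $X$ contains a non-constant function. Suppose that there exists a non-trivial (i.e. non-zero) decent linear functional $L$ on $Y$ which is continuous with respect to $\rho_Y$. Let $g$ be an analytic function in $\mathbb{D}$. Then the following statements hold. (i) If $M_g$ is continuous from $(X,\rho_X)$ into $(Y,\rho_Y)$, then $g\in H^\infty$. (ii) If $I_g$ is continuous from $(X,\rho_X)$ into $(Y,\rho_Y)$, then $g\in H^\infty$.
   Context: $\mathbb{D}=\{z\in\mathbb{C}:|z|<1\}$; $\mathrm{Hol}(\mathbb{D})$ is the space of all analytic functions in $\mathbb{D}$ with the topology of uniform convergence on compact subsets; $H^\infty$ is the space of bounded analytic functions in $\mathbb{D}$. $\mathrm{Aut}(\mathbb{D})$ is the set of all one-to-one analytic maps of $\mathbb{D}$ onto itself. A linear space $X$ of analytic functions in $\mathbb{D}$ is Möbius (conformally) invariant if $f\in X$ implies $f\circ\varphi\in X$ for every $\varphi\in\mathrm{Aut}(\mathbb{D})$ and, moreover, $X$ is equipped with a seminorm $\rho$ for which there is a constant $C>0$ such that $\rho(f\circ\varphi)\le C\rho(f)$ for all $f\in X$, $\varphi\in\mathrm{Aut}(\mathbb{D})$. A linear functional $L$ on $Y$ is called decent if it extends to a continuous linear functional on $\mathrm{Hol}(\mathbb{D})$. Continuity of $L$ with respect to $\rho_Y$ means $|L(f)|\le C\rho_Y(f)$ for all $f\in Y$. For $g\in\mathrm{Hol}(\mathbb{D})$: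 $M_g(f)(z)=g(z)f(z)$ and $I_g(f)(z)=\int_0^z g(\xi)f'(\xi)\,d\xi$ for $f\in\mathrm{Hol}(\mathbb{D})$, $z\in\mathbb{D}$. Such an operator $T$ is continuous from $(X,\rho_X)$ into $(Y,\rho_Y)$ if $T(X)\subset Y$ and there is a constant $C$ with $\rho_Y(T f)\le C\rho_X(f)$ for all $f\in X$. *)

theory Defs
  imports "HOL-Complex_Analysis.Complex_Analysis"
begin

abbreviation disc :: "complex set" where
  "disc \<equiv> ball 0 1"

text \<open>
  An analytic function in the disc is represented by the total function that extends it by 0,
  so that equality of representatives is equality on the disc. A space of analytic functions is
  then a subset of \<open>hol_disc\<close>, and pointwise sums and scalar multiples stay inside
  \<open>hol_disc\<close>; composition and integration have to be cut off outside the disc.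
\<close>

definition hol_disc :: "(complex \<Rightarrow> complex) set" where
  "hol_disc = {f. f holomorphic_on disc \<and> (\<forall>z. z \<notin> disc \<longrightarrow> f z = 0)}"

text \<open>The topology of uniform convergence on compact subsets.\<close>

definition hol_open :: "(complex \<Rightarrow> complex) set \<Rightarrow> bool" where
  "hol_open U \<longleftrightarrow> U \<subseteq> hol_disc \<and>
     (\<forall>f\<in>U. \<exists>K e. compact K \<and> K \<subseteq> disc \<and> e > 0 \<and>
        {h \<in> hol_disc. \<forall>z\<in>K. cmod (h z - f z) < e} \<subseteq> U)"

definition hol_topology :: "(complex \<Rightarrow> complex) topology" where
  "hol_topology = topology hol_open"

lemma istopology_hol_open: "istopology hol_open"
  unfolding istopology_def
proof (intro conjI allI impI)
  fix S T assume S: "hol_open S" and T: "hol_open T"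
  show "hol_open (S \<inter> T)"
    unfolding hol_open_def
  proof (intro conjI ballI)
    show "S \<inter> T \<subseteq> hol_disc"
      using S by (auto simp: hol_open_def)
  next
    fix f assume f: "f \<in> S \<inter> T"
    obtain K d where K: "compact K" "K \<subseteq> disc" "d > 0"
      "{h \<in> hol_disc. \<forall>z\<in>K. cmod (h z - f z) < d} \<subseteq> S"
      using S f unfolding hol_open_def by blast
    obtain K' d' where K': "compact K'" "K' \<subseteq> disc" "d' > 0"
      "{h \<in> hol_disc. \<forall>z\<in>K'. cmod (h z - f z) < d'} \<subseteq> T"
      using T f unfolding hol_open_def by blast
    have "{h \<in> hol_disc. \<forall>z\<in>K \<union> K'. cmod (h z - f z) < min d d'} \<subseteq> S \<inter> T"
      using K(4) K'(4) by auto
    moreover have "compact (K \<union> K')" "K \<union> K' \<subseteq> disc" "min d d' > 0"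
      using K(1-3) K'(1-3) by (simp_all add: compact_Un)
    ultimately show "\<exists>K e. compact K \<and> K \<subseteq> disc \<and> e > 0 \<and>
        {h \<in> hol_disc. \<forall>z\<in>K. cmod (h z - f z) < e} \<subseteq> S \<inter> T"
      by (intro exI conjI)
  qed
next
  fix \<K> assume *: "\<forall>S\<in>\<K>. hol_open S"
  show "hol_open (\<Union>\<K>)"
    unfolding hol_open_def
  proof (intro conjI ballI)
    show "\<Union>\<K> \<subseteq> hol_disc"
      using * by (auto simp: hol_open_def)
  next
    fix f assume "f \<in> \<Union>\<K>"
    then obtain S where S: "S \<in> \<K>" "f \<in> S" by blast
    from * S(1) have "hol_open S" ..
    with S(2) obtain K e where "compact K" "K \<subseteq> disc" "e > 0"
      "{h \<in> hol_disc. \<forall>z\<in>K. cmod (h z - f z) < e} \<subseteq> S"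
      unfolding hol_open_def by blast
    moreover from this(4) S(1) have
      "{h \<in> hol_disc. \<forall>z\<in>K. cmod (h z - f z) < e} \<subseteq> \<Union>\<K>"
      by (meson Union_upper subset_trans)
    ultimately show "\<exists>K e. compact K \<and> K \<subseteq> disc \<and> e > 0 \<and>
        {h \<in> hol_disc. \<forall>z\<in>K. cmod (h z - f z) < e} \<subseteq> \<Union>\<K>"
      by (intro exI conjI)
  qed
qed

lemma openin_hol_topology: "openin hol_topology U \<longleftrightarrow> hol_open U"
  by (simp add: hol_topology_def topology_inverse'[OF istopology_hol_open])

lemma topspace_hol_topology: "topspace hol_topology = hol_disc"
proof -
  have "hol_open hol_disc"
    unfolding hol_open_def by (intro conjI ballI exI[of _ "{}"] exI[of _ 1]) simp_all
  then show ?thesis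
    unfolding topspace_def openin_hol_topology by (auto simp: hol_open_def)
qed

definition H_inf :: "(complex \<Rightarrow> complex) set" where
  "H_inf = {f \<in> hol_disc. bounded (f ` disc)}"

text \<open>Only the values on the disc of a member of \<open>Aut_disc\<close> matter.\<close>

definition Aut_disc :: "(complex \<Rightarrow> complex) set" where
  "Aut_disc = {\<phi>. \<phi> holomorphic_on disc \<and> bij_betw \<phi> disc disc}"

definition comp_disc :: "(complex \<Rightarrow> complex) \<Rightarrow> (complex \<Rightarrow> complex) \<Rightarrow> complex \<Rightarrow> complex" where
  "comp_disc f \<phi> = (\<lambda>z. if z \<in> disc then f (\<phi> z) else 0)"

definition linear_space :: "(complex \<Rightarrow> complex) set \<Rightarrow> bool" where
  "linear_space X \<longleftrightarrow> (\<lambda>z. 0) \<in> X \<and>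
     (\<forall>f\<in>X. \<forall>h\<in>X. (\<lambda>z. f z + h z) \<in> X) \<and>
     (\<forall>c. \<forall>f\<in>X. (\<lambda>z. c * f z) \<in> X)"

definition seminorm_on ::
  "(complex \<Rightarrow> complex) set \<Rightarrow> ((complex \<Rightarrow> complex) \<Rightarrow> real) \<Rightarrow> bool" where
  "seminorm_on X \<rho> \<longleftrightarrow> (\<forall>f\<in>X. 0 \<le> \<rho> f) \<and>
     (\<forall>f\<in>X. \<forall>h\<in>X. \<rho> (\<lambda>z. f z + h z) \<le> \<rho> f + \<rho> h) \<and>
     (\<forall>c. \<forall>f\<in>X. \<rho> (\<lambda>z. c * f z) = cmod c * \<rho> f)"

definition moebius_invariant ::
  "(complex \<Rightarrow> complex) set \<Rightarrow> ((complex \<Rightarrow> complex) \<Rightarrow> real) \<Rightarrow> bool" where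
  "moebius_invariant X \<rho> \<longleftrightarrow> X \<subseteq> hol_disc \<and> linear_space X \<and>
     (\<forall>f\<in>X. \<forall>\<phi>\<in>Aut_disc. comp_disc f \<phi> \<in> X) \<and>
     seminorm_on X \<rho> \<and>
     (\<exists>C>0. \<forall>f\<in>X. \<forall>\<phi>\<in>Aut_disc. \<rho> (comp_disc f \<phi>) \<le> C * \<rho> f)"

definition linear_functional_on ::
  "(complex \<Rightarrow> complex) set \<Rightarrow> ((complex \<Rightarrow> complex) \<Rightarrow> complex) \<Rightarrow> bool" where
  "linear_functional_on Y L \<longleftrightarrow>
     (\<forall>f\<in>Y. \<forall>h\<in>Y. L (\<lambda>z. f z + h z) = L f + L h) \<and>
     (\<forall>c. \<forall>f\<in>Y. L (\<lambda>z. c * f z) = c * L f)"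

definition decent ::
  "(complex \<Rightarrow> complex) set \<Rightarrow> ((complex \<Rightarrow> complex) \<Rightarrow> complex) \<Rightarrow> bool" where
  "decent Y L \<longleftrightarrow>
     (\<exists>\<Lambda>. linear_functional_on hol_disc \<Lambda> \<and> continuous_map hol_topology euclidean \<Lambda> \<and>
          (\<forall>f\<in>Y. \<Lambda> f = L f))"

definition continuous_functional ::
  "(complex \<Rightarrow> complex) set \<Rightarrow> ((complex \<Rightarrow> complex) \<Rightarrow> real) \<Rightarrow>
   ((complex \<Rightarrow> complex) \<Rightarrow> complex) \<Rightarrow> bool" where
  "continuous_functional Y \<rho> L \<longleftrightarrow> (\<exists>C. \<forall>f\<in>Y. cmod (L f) \<le> C * \<rho> f)"

definition mult_op :: "(complex \<Rightarrow> complex) \<Rightarrow> (complex \<Rightarrow> complex) \<Rightarrow> complex \<Rightarrow> complex" where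
  "mult_op g f = (\<lambda>z. g z * f z)"

definition int_op :: "(complex \<Rightarrow> complex) \<Rightarrow> (complex \<Rightarrow> complex) \<Rightarrow> complex \<Rightarrow> complex" where
  "int_op g f = (\<lambda>z. if z \<in> disc
     then contour_integral (linepath 0 z) (\<lambda>\<xi>. g \<xi> * deriv f \<xi>) else 0)"

definition continuous_operator ::
  "(complex \<Rightarrow> complex) set \<Rightarrow> ((complex \<Rightarrow> complex) \<Rightarrow> real) \<Rightarrow>
   (complex \<Rightarrow> complex) set \<Rightarrow> ((complex \<Rightarrow> complex) \<Rightarrow> real) \<Rightarrow>
   ((complex \<Rightarrow> complex) \<Rightarrow> complex \<Rightarrow> complex) \<Rightarrow> bool" where
  "continuous_operator X \<rho>X Y \<rho>Y T \<longleftrightarrow>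
     T ` X \<subseteq> Y \<and> (\<exists>C. \<forall>f\<in>X. \<rho>Y (T f) \<le> C * \<rho>X f)"

end

theory Submission
  imports Defs
begin

text \<open>
  Write \<open>a\<^sub>n(h)\<close> for the Taylor coefficients of \<open>h\<close> at 0, and let \<open>\<Lambda>\<close> be the continuous extension of
  \<open>L\<close> to all analytic functions. Averaging \<open>h(c\<cdot>\<phi>(z))\<close> over roots of unity \<open>c\<close> with the weights
  \<open>c\<^sup>-\<^sup>n\<close> isolates the term \<open>a\<^sub>n(h) \<phi>(z)\<^sup>n\<close> in the limit, so a bound on \<open>\<Lambda>\<close> that is uniform
  under rotations passes to \<open>\<bar>a\<^sub>n(h)\<bar>\<cdot>\<bar>\<Lambda>(\<phi>\<^sup>n)\<bar>\<close>. This is used twice. If \<open>\<Lambda>\<close> vanished on every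
  automorphism, then applying it to one Moebius map all of whose Taylor coefficients are nonzero
  (and \<open>\<phi>(z) = z\<close>) would show that \<open>\<Lambda>\<close> kills all monomials, hence everything. So
  \<open>\<Lambda>(\<phi>) \<noteq> 0\<close> for some automorphism \<open>\<phi>\<close>, and then the case \<open>n = 1\<close> gives
  \<open>\<bar>h'(0)\<bar> \<le> C \<rho>\<^sub>Y(h)\<close> on \<open>Y\<close>.

  Choose \<open>F\<close> in \<open>X\<close> with \<open>F'(0) \<noteq> 0\<close>, and for a point \<open>w\<close> of the disc an automorphism \<open>\<psi>\<close> with
  \<open>\<psi>(0) = w\<close>. The function \<open>h = T(F \<circ> \<psi>\<^sup>-\<^sup>1) \<circ> \<psi>\<close> lies in \<open>Y\<close>, with seminorm bounded
  independently of \<open>w\<close>. For \<open>T = I\<^sub>g\<close>, \<open>h'(0) = g(w) F'(0)\<close>. For \<open>T = M\<^sub>g\<close>,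
  \<open>h'(0) = (g \<circ> \<psi>)'(0) F(0) + g(w) F'(0)\<close>, and the first summand cancels on adding the same
  identity for \<open>\<psi>(-z)\<close>. In both cases \<open>\<bar>g(w)\<bar>\<cdot>\<bar>F'(0)\<bar>\<close> is bounded.
\<close>

section \<open>Averages of power series over roots of unity\<close>

text \<open>Multipliers of modulus at most 1 leave the series dominated on \<open>K\<close> by one
  absolutely convergent series, so agreement of the first \<open>N\<close> multipliers leaves an
  error of at most twice its tail. This covers both root-of-unity averages and Taylor partial
  sums.\<close>

lemma power_series_multiplier_limit:
  fixes a :: "nat \<Rightarrow> complex" and c :: "nat \<Rightarrow> nat \<Rightarrow> complex"
  assumes sm: "\<And>w. w \<in> disc \<Longrightarrow> summable (\<lambda>m. a m * w ^ m)"
    and c: "\<And>N m. cmod (c N m) \<le> 1" and d: "\<And>m. cmod (d m) \<le> 1"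
    and ev: "\<forall>\<^sub>F N in sequentially. \<forall>m<N. c N m = d m"
    and K: "compact K" "K \<subseteq> disc"
  shows "uniform_limit K (\<lambda>N w. \<Sum>m. c N m * (a m * w ^ m)) (\<lambda>w. \<Sum>m. d m * (a m * w ^ m)) sequentially"
proof -
  obtain r where r: "0 < r" "r < 1" "K \<subseteq> cball 0 r"
  proof (cases "K = {}")
    case True
    then show thesis using that[of "1/2"] by auto
  next
    case False
    obtain x where x: "x \<in> K" "\<forall>y\<in>K. cmod y \<le> cmod x"
      using continuous_attains_sup[OF K(1) False, of cmod] by (auto intro: continuous_intros)
    have "cmod x < 1" using x K by auto
    \<comment> \<open>The midpoint between the largest modulus on \<open>K\<close> and 1 is positive
      even for \<open>K = {0}\<close>.\<close>
    then show thesis using x by (intro that[of "(1 + cmod x)/2"]) (auto intro!: add_pos_nonneg)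
  qed
  define t where "t m = cmod (a m * of_real r ^ m)" for m
  \<comment> \<open>Convergence at a point of modulus strictly between \<open>r\<close> and 1 gives
    absolute convergence at \<open>r\<close>.\<close>
  have "summable (\<lambda>m. a m * of_real ((1 + r)/2) ^ m)"
    using r by (intro sm) (simp del: of_real_divide of_real_add)
  then have t: "summable t"
    unfolding t_def by (rule powser_insidea) (use r in \<open>simp del: of_real_divide of_real_add\<close>)
  have bd: "cmod (a m * w ^ m) \<le> t m" if "w \<in> K" for w m
  proof -
    have "cmod w \<le> r" using that r by auto
    then show ?thesis using r
      by (auto simp: t_def norm_mult norm_power intro!: mult_left_mono power_mono)
  qed
  have tail: "cmod ((\<Sum>m. c N m * (a m * w ^ m)) - (\<Sum>m. d m * (a m * w ^ m))) \<le> 2 * (\<Sum>k. t (k + N))"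
    if "w \<in> K" and eq: "\<forall>m<N. c N m = d m" for w N
  proof -
    have s: "summable (\<lambda>m. e m * (a m * w ^ m))" if "\<And>m. cmod (e m) \<le> 1" for e
      using that bd[OF \<open>w \<in> K\<close>] mult_mono[of "cmod (e _)" 1 "cmod (a _ * w ^ _)" "t _"]
      by (intro summable_comparison_test'[OF t, of 0]) (simp add: norm_mult)
    define f where "f m = (c N m - d m) * (a m * w ^ m)" for m
    have sf: "summable f"
      unfolding f_def left_diff_distrib by (intro summable_diff s c d)
    have "cmod (c N m - d m) \<le> 2" for m
      using c[of N m] d[of m] norm_triangle_ineq4[of "c N m" "d m"] by linarith
    then have nf: "cmod (f m) \<le> 2 * t m" for m
      unfolding f_def norm_mult[of "c N m - d m"] using bd[OF \<open>w \<in> K\<close>, of m] by (intro mult_mono) auto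
    have "(\<Sum>m. c N m * (a m * w ^ m)) - (\<Sum>m. d m * (a m * w ^ m)) = suminf f"
      unfolding f_def left_diff_distrib by (intro suminf_diff s c d)
    also have "\<dots> = (\<Sum>k. f (k + N)) + sum f {..<N}"
      by (rule suminf_split_initial_segment[OF sf])
    also have "sum f {..<N} = 0"
      using eq by (simp add: f_def)
    also have "cmod ((\<Sum>k. f (k + N)) + 0) \<le> (\<Sum>k. 2 * t (k + N))"
      using nf t by (simp only: add_0_right, intro norm_suminf_le) (auto simp: summable_iff_shift intro: summable_mult)
    also have "\<dots> = 2 * (\<Sum>k. t (k + N))"
      using t by (intro suminf_mult) (simp add: summable_iff_shift)
    finally show ?thesis .
  qed
  have lim: "(\<lambda>N. 2 * (\<Sum>k. t (k + N))) \<longlonglongrightarrow> 0"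
    using tendsto_mult_left[OF suminf_exist_split2[OF t], of 2] by simp
  show ?thesis
  proof (rule uniform_limitI)
    fix e :: real assume "0 < e"
    then have "\<forall>\<^sub>F N in sequentially. 2 * (\<Sum>k. t (k + N)) < e"
      by (rule order_tendstoD(2)[OF lim])
    with ev show "\<forall>\<^sub>F N in sequentially. \<forall>w\<in>K. dist (\<Sum>m. c N m * (a m * w ^ m)) (\<Sum>m. d m * (a m * w ^ m)) < e"
      unfolding dist_norm by eventually_elim (blast intro: tail le_less_trans)
  qed
qed

text \<open>The sum is geometric with ratio \<open>x\<close>, an \<open>N\<close>-th root of unity.
  As \<open>m\<close> and \<open>n\<close> are both below \<open>N\<close>, this ratio equals 1 only
  for \<open>m = n\<close>.\<close>

lemma unity_roots_orthogonal:
  assumes "m < N" "n < N"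
  shows "(\<Sum>j<N. cnj (cis (2 * pi * real j / real N)) ^ n * cis (2 * pi * real j / real N) ^ m)
     = (if m = n then of_nat N else 0)"
proof -
  define u where "u k = cis (2 * pi * real k / real N)" for k
  define x where "x = cnj (u n) * u m"
  have N: "N > 0" using assms by auto
  have u: "cnj (u k) * u k = 1" for k
    by (simp add: u_def cis_cnj cis_mult)
  have uN: "u k ^ N = 1" for k
    using N by (simp add: u_def Complex.DeMoivre)
  \<comment> \<open>Exchanging index and exponent turns the summand into the \<open>j\<close>-th
    power of a ratio independent of \<open>j\<close>.\<close>
  have swap: "u j ^ k = u k ^ j" for j k
    by (simp add: u_def Complex.DeMoivre mult_ac)
  have eq: "cnj (u j) ^ n * u j ^ m = x ^ j" for j
    unfolding x_def power_mult_distrib using swap[of j m] swap[of j n]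
    by (simp flip: complex_cnj_power)
  have "(\<Sum>j<N. x ^ j) = (if m = n then of_nat N else 0)"
  proof (cases "m = n")
    case True then show ?thesis by (simp add: x_def u)
  next
    case False
    have "x \<noteq> 1"
    proof
      assume "x = 1"
      have "u m = cnj (u n) * u n * u m" by (simp only: u mult_1)
      also have "\<dots> = u n * x" by (simp add: x_def)
      also have "\<dots> = u n" by (simp add: \<open>x = 1\<close>)
      finally have "u m = u n" .
      moreover have "inj_on u {..<N}"
        using bij_betw_imp_inj_on[OF Complex.bij_betw_roots_unity[OF N]] by (simp add: u_def inj_on_def)
      ultimately show False using False assms by (auto dest: inj_onD)
    qed
    moreover have "x ^ N = 1"
      by (simp only: x_def power_mult_distrib uN complex_cnj_one mult_1 flip: complex_cnj_power)
    ultimately show ?thesis using False by (simp add: geometric_sum)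
  qed
  then show ?thesis by (simp add: eq flip: u_def)
qed

text \<open>Averaging multiplies the \<open>m\<close>-th term by \<open>c N m\<close>, which by
  orthogonality is 1 or 0 for \<open>m < N\<close> once \<open>n < N\<close>. Terms with
  \<open>m \<ge> N\<close> may survive by aliasing, but their multipliers have modulus at most
  1.\<close>

lemma unity_root_average_limit:
  fixes a :: "nat \<Rightarrow> complex"
  assumes h: "\<And>w. w \<in> disc \<Longrightarrow> (\<lambda>m. a m * w ^ m) sums h w"
    and K: "compact K" "K \<subseteq> disc"
  shows "uniform_limit K
     (\<lambda>N w. \<Sum>j<N. cnj (cis (2 * pi * real j / real N)) ^ n / of_nat N * h (cis (2 * pi * real j / real N) * w))
     (\<lambda>w. a n * w ^ n) sequentially"
proof -
  define u where "u N j = cis (2 * pi * real j / real N)" for N j :: nat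
  have u[simp]: "cmod (u N j) = 1" for N j by (simp add: u_def)
  define c where "c N m = (\<Sum>j<N. cnj (u N j) ^ n / of_nat N * u N j ^ m)" for N m
  define d :: "nat \<Rightarrow> complex" where "d m = (if m = n then 1 else 0)" for m
  have "cmod (c N m) \<le> 1" for N m
  proof -
    have "cmod (c N m) \<le> (\<Sum>j<N. 1 / real N)"
      unfolding c_def by (intro sum_norm_le) (simp add: norm_mult norm_divide norm_power)
    \<comment> \<open>Equality fails for \<open>N = 0\<close>, where the sum is empty.\<close>
    also have "\<dots> \<le> 1" by (simp add: divide_simps)
    finally show ?thesis .
  qed
  moreover have "cmod (d m) \<le> 1" for m by (simp add: d_def)
  moreover have "\<forall>\<^sub>F N in sequentially. \<forall>m<N. c N m = d m"
    using eventually_gt_at_top[of n]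
  proof eventually_elim
    case (elim N)
    show ?case
    proof (intro allI impI)
      fix m assume "m < N"
      have "c N m = (\<Sum>j<N. cnj (u N j) ^ n * u N j ^ m) / of_nat N"
        by (simp add: c_def sum_divide_distrib)
      also have "\<dots> = d m"
        using unity_roots_orthogonal[OF \<open>m < N\<close> elim] elim by (simp add: u_def d_def)
      finally show "c N m = d m" .
    qed
  qed
  ultimately have "uniform_limit K (\<lambda>N w. \<Sum>m. c N m * (a m * w ^ m)) (\<lambda>w. \<Sum>m. d m * (a m * w ^ m)) sequentially"
    using K by (intro power_series_multiplier_limit) (use h in \<open>auto simp: sums_iff\<close>)
  moreover have "(\<Sum>m. d m * (a m * w ^ m)) = a n * w ^ n" for w
    using suminf_finite[of "{n}" "\<lambda>m. d m * (a m * w ^ m)"] by (auto simp: d_def)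
  moreover have "(\<Sum>m. c N m * (a m * w ^ m)) = (\<Sum>j<N. cnj (u N j) ^ n / of_nat N * h (u N j * w))"
    if "w \<in> K" for N w
  proof (rule sums_unique[symmetric])
    have "(\<lambda>m. \<Sum>j<N. cnj (u N j) ^ n / of_nat N * (a m * (u N j * w) ^ m)) sums
        (\<Sum>j<N. cnj (u N j) ^ n / of_nat N * h (u N j * w))"
      using K that by (intro sums_sum sums_mult h) (auto simp: norm_mult)
    moreover have "(\<Sum>j<N. cnj (u N j) ^ n / of_nat N * (a m * (u N j * w) ^ m)) = c N m * (a m * w ^ m)" for m
      unfolding c_def sum_distrib_right by (intro sum.cong) (simp_all add: power_mult_distrib)
    ultimately show "(\<lambda>m. c N m * (a m * w ^ m)) sums (\<Sum>j<N. cnj (u N j) ^ n / of_nat N * h (u N j * w))"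
      by simp
  qed
  ultimately show ?thesis
    by (simp add: u_def cong: uniform_limit_cong')
qed

section \<open>Continuous functionals on the analytic functions of the disc\<close>

lemma linear_functional_on_sum:
  assumes V: "linear_space V" and L: "linear_functional_on V L" and J: "finite J" "\<And>j. j \<in> J \<Longrightarrow> f j \<in> V"
  shows "(\<lambda>z. \<Sum>j\<in>J. k j * f j z) \<in> V \<and> L (\<lambda>z. \<Sum>j\<in>J. k j * f j z) = (\<Sum>j\<in>J. k j * L (f j))"
  using J
proof (induction J rule: finite_induct)
  case empty
  have z: "(\<lambda>z. 0) \<in> V" using V by (simp add: linear_space_def)
  \<comment> \<open>Homogeneity with the scalar 0 shows that \<open>L\<close> vanishes at the zero
    function.\<close>
  have "\<forall>c. \<forall>f\<in>V. L (\<lambda>z. c * f z) = c * L f"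
    using L by (simp add: linear_functional_on_def)
  from this[rule_format, of _ 0, OF z] z show ?case by simp
next
  case (insert j J)
  have "(\<lambda>z. k j * f j z) \<in> V" "L (\<lambda>z. k j * f j z) = k j * L (f j)"
    using insert.prems V L unfolding linear_space_def linear_functional_on_def by auto
  moreover have "(\<lambda>z. \<Sum>j\<in>J. k j * f j z) \<in> V"
      "L (\<lambda>z. \<Sum>j\<in>J. k j * f j z) = (\<Sum>j\<in>J. k j * L (f j))"
    using insert by auto
  ultimately show ?case
    using insert.hyps V L unfolding linear_space_def linear_functional_on_def by simp
qed

lemma linear_space_hol_disc: "linear_space hol_disc"
  unfolding linear_space_def hol_disc_def by (auto intro!: holomorphic_intros)

lemma comp_disc_in_hol_disc:
  assumes "f holomorphic_on disc" "\<phi> holomorphic_on disc" "\<phi> ` disc \<subseteq> disc"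
  shows "comp_disc f \<phi> \<in> hol_disc"
proof -
  have "(f \<circ> \<phi>) holomorphic_on disc"
    using assms by (intro holomorphic_on_compose_gen)
  then have "comp_disc f \<phi> holomorphic_on disc"
    by (rule holomorphic_transform) (simp add: comp_disc_def)
  then show ?thesis by (auto simp: hol_disc_def comp_disc_def)
qed

text \<open>Every neighbourhood of \<open>v\<close> contains a basic one given by a single compact
  set and a single tolerance, so locally uniform convergence is convergence in
  \<open>hol_topology\<close>.\<close>

lemma hol_functional_tendsto:
  assumes \<Lambda>: "continuous_map hol_topology euclidean (\<Lambda> :: (complex \<Rightarrow> complex) \<Rightarrow> complex)"
    and u: "\<And>N. u N \<in> hol_disc" "v \<in> hol_disc"
    and lim: "\<And>K. compact K \<Longrightarrow> K \<subseteq> disc \<Longrightarrow> uniform_limit K u v sequentially"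
  shows "(\<lambda>N. \<Lambda> (u N)) \<longlonglongrightarrow> \<Lambda> v"
proof -
  have "limitin hol_topology u v sequentially"
    unfolding limitin_def
  proof (intro conjI allI impI)
    show "v \<in> topspace hol_topology" using u by (simp add: topspace_hol_topology)
    fix U assume U: "openin hol_topology U \<and> v \<in> U"
    then obtain K e where K: "compact K" "K \<subseteq> disc" "e > 0"
        "{h \<in> hol_disc. \<forall>z\<in>K. cmod (h z - v z) < e} \<subseteq> U"
      unfolding openin_hol_topology hol_open_def by blast
    have "\<forall>\<^sub>F N in sequentially. \<forall>z\<in>K. dist (u N z) (v z) < e"
      using lim[OF K(1,2)] K(3) by (rule uniform_limitD)
    then show "\<forall>\<^sub>F N in sequentially. u N \<in> U"
      by eventually_elim (use K(4) u(1) in \<open>auto simp: dist_norm\<close>)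
  qed
  from continuous_map_limit[OF \<Lambda> this] show ?thesis by (simp add: o_def)
qed

text \<open>The averages \<open>v N\<close> of the functions \<open>h (c * \<phi> z)\<close>
  converge locally uniformly to the \<open>n\<close>-th term of the series at
  \<open>\<phi> z\<close>. Their weights have moduli summing to 1, so the bound \<open>M\<close>
  survives averaging and, by continuity of \<open>\<Lambda>\<close>, the limit.\<close>

lemma hol_functional_coefficient_bound:
  fixes a :: "nat \<Rightarrow> complex"
  assumes \<Lambda>: "linear_functional_on hol_disc \<Lambda>" "continuous_map hol_topology euclidean \<Lambda>"
    and hol: "h holomorphic_on disc"
    and h: "\<And>w. w \<in> disc \<Longrightarrow> (\<lambda>m. a m * w ^ m) sums h w"
    and \<phi>: "\<phi> holomorphic_on disc" "\<phi> ` disc \<subseteq> disc"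
    and M: "\<And>c. cmod c = 1 \<Longrightarrow> cmod (\<Lambda> (comp_disc h (\<lambda>z. c * \<phi> z))) \<le> M"
  shows "cmod (a n) * cmod (\<Lambda> (comp_disc (\<lambda>w. w ^ n) \<phi>)) \<le> M"
proof -
  define u where "u N j = cis (2 * pi * real j / real N)" for N j :: nat
  have u[simp]: "cmod (u N j) = 1" for N j by (simp add: u_def)
  define k where "k N j = cnj (u N j) ^ n / of_nat N" for N j
  define f where "f N j = comp_disc h (\<lambda>z. u N j * \<phi> z)" for N j
  define v where "v N = (\<lambda>z. \<Sum>j<N. k N j * f N j z)" for N
  define p where "p = comp_disc (\<lambda>w. w ^ n) \<phi>"
  have f: "f N j \<in> hol_disc" for N j
    unfolding f_def using \<phi> by (intro comp_disc_in_hol_disc hol holomorphic_intros) (auto simp: norm_mult)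
  have p: "p \<in> hol_disc"
    unfolding p_def using \<phi> by (intro comp_disc_in_hol_disc holomorphic_intros)
  have v: "v N \<in> hol_disc" "\<Lambda> (v N) = (\<Sum>j<N. k N j * \<Lambda> (f N j))" for N
    using linear_functional_on_sum[OF linear_space_hol_disc \<Lambda>(1), of "{..<N}" "f N"] f
    by (auto simp: v_def)
  have ap: "(\<lambda>z. a n * p z) \<in> hol_disc" "\<Lambda> (\<lambda>z. a n * p z) = a n * \<Lambda> p"
    using p \<Lambda>(1) linear_space_hol_disc unfolding linear_space_def linear_functional_on_def by auto
  have "uniform_limit K v (\<lambda>z. a n * p z) sequentially" if K: "compact K" "K \<subseteq> disc" for K
  proof -
    \<comment> \<open>Uniformity in \<open>z\<close> on \<open>K\<close> follows from uniformity in
      \<open>w\<close> on the compact image of \<open>K\<close>.\<close>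
    have "compact (\<phi> ` K)" 
      using K \<phi>(1) by (meson compact_continuous_image continuous_on_subset holomorphic_on_imp_continuous_on)
    moreover have "\<phi> ` K \<subseteq> disc" using K \<phi>(2) by blast
    ultimately have "uniform_limit (\<phi> ` K) (\<lambda>N w. \<Sum>j<N. k N j * h (u N j * w)) (\<lambda>w. a n * w ^ n) sequentially"
      unfolding k_def u_def by (intro unity_root_average_limit h)
    then have "uniform_limit K (\<lambda>N z. \<Sum>j<N. k N j * h (u N j * \<phi> z)) (\<lambda>z. a n * \<phi> z ^ n) sequentially"
      unfolding uniform_limit_iff by auto
    then show ?thesis
      by (rule uniform_limit_cong'[THEN iffD1, rotated -1])
         (use K in \<open>auto simp: v_def f_def p_def comp_disc_def subset_iff\<close>)
  qed
  then have "(\<lambda>N. \<Lambda> (v N)) \<longlonglongrightarrow> a n * \<Lambda> p"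
    using hol_functional_tendsto[OF \<Lambda>(2) v(1) ap(1)] ap(2) by simp
  then have lim: "(\<lambda>N. cmod (\<Lambda> (v N))) \<longlonglongrightarrow> cmod (a n * \<Lambda> p)"
    by (rule tendsto_norm)
  have "\<forall>\<^sub>F N in sequentially. cmod (\<Lambda> (v N)) \<le> M"
    using eventually_gt_at_top[of 0]
  proof eventually_elim
    case (elim N)
    have "cmod (\<Lambda> (v N)) \<le> (\<Sum>j<N. M / real N)"
      unfolding v(2) using M elim
      by (intro sum_norm_le) (simp add: k_def f_def norm_mult norm_divide norm_power divide_right_mono)
    also have "\<dots> = M" using elim by simp
    finally show ?case .
  qed
  then show ?thesis
    using tendsto_upperbound[OF lim] by (simp add: norm_mult p_def)
qed


section \<open>Automorphisms of the disc\<close>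

lemma Aut_discD:
  assumes "\<phi> \<in> Aut_disc"
  shows "\<phi> holomorphic_on disc" "\<phi> ` disc \<subseteq> disc" "z \<in> disc \<Longrightarrow> \<phi> z \<in> disc"
  using assms by (auto simp: Aut_disc_def bij_betw_def)

lemma Aut_disc_compose:
  assumes "\<phi> \<in> Aut_disc" "\<psi> \<in> Aut_disc"
  shows "(\<lambda>z. \<phi> (\<psi> z)) \<in> Aut_disc"
proof -
  have "(\<phi> \<circ> \<psi>) holomorphic_on disc"
    using Aut_discD[OF assms(1)] Aut_discD[OF assms(2)] by (intro holomorphic_on_compose_gen)
  moreover have "bij_betw (\<phi> \<circ> \<psi>) disc disc"
    using assms by (auto simp: Aut_disc_def intro: bij_betw_trans)
  ultimately show ?thesis by (simp add: Aut_disc_def o_def)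
qed

lemma rotation_in_Aut_disc:
  assumes "cmod c = 1"
  shows "(\<lambda>z. c * z) \<in> Aut_disc"
proof -
  have "c \<noteq> 0" using assms by auto
  then have "bij_betw (\<lambda>z. c * z) disc disc"
    using assms
    by (intro bij_betw_byWitness[where f' = "\<lambda>z. inverse c * z"])
       (auto simp: norm_mult norm_inverse simp flip: mult.assoc)
  then show ?thesis by (auto simp: Aut_disc_def intro!: holomorphic_intros)
qed

lemma Moebius_function_in_Aut_disc:
  assumes "cmod w < 1"
  shows "Moebius_function 0 w \<in> Aut_disc"
proof -
  have "bij_betw (Moebius_function 0 w) disc disc"
    using assms
    by (intro bij_betw_byWitness[where f' = "Moebius_function 0 (- w)"])
       (auto intro!: Moebius_function_compose Moebius_function_norm_lt_1)
  then show ?thesis using assms by (simp add: Aut_disc_def Moebius_function_holomorphic)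
qed

lemma Aut_disc_transitive:
  assumes "w \<in> disc"
  obtains \<psi> \<eta> where "\<psi> \<in> Aut_disc" "\<eta> \<in> Aut_disc" "\<psi> 0 = w" "\<And>z. z \<in> disc \<Longrightarrow> \<eta> (\<psi> z) = z"
proof
  show "Moebius_function 0 (- w) \<in> Aut_disc" "Moebius_function 0 w \<in> Aut_disc"
    using assms by (auto intro: Moebius_function_in_Aut_disc)
  show "Moebius_function 0 (- w) 0 = w" by (simp add: Moebius_function_of_zero)
  show "Moebius_function 0 w (Moebius_function 0 (- w) z) = z" if "z \<in> disc" for z
    using assms that by (intro Moebius_function_compose) auto
qed

text \<open>Division with remainder writes the map as \<open>3/2 * (1 / (1 - w/2)) - 2\<close>,
  followed by the geometric series. The constant term is \<open>-1/2\<close>, so no coefficient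
  vanishes.\<close>

lemma Moebius_half_sums:
  fixes w :: complex
  assumes "w \<in> disc"
  shows "(\<lambda>m. (3/2 * (1/2) ^ m - (if m = 0 then 2 else 0)) * w ^ m) sums Moebius_function 0 (1/2) w"
proof -
  have "(\<lambda>m. 3/2 * (w/2) ^ m) sums (3/2 * (1 / (1 - w/2)))"
    using assms by (intro sums_mult geometric_sums) (simp add: norm_divide)
  moreover have "(\<lambda>m. if m = 0 then 2 else 0) sums (2::complex)"
    using sums_single[of 0 "\<lambda>_. 2::complex"] by simp
  ultimately have "(\<lambda>m. 3/2 * (w/2) ^ m - (if m = 0 then 2 else 0)) sums (3/2 * (1 / (1 - w/2)) - 2)"
    by (rule sums_diff)
  moreover have "2 - w \<noteq> 0" using assms by auto
  then have "3/2 * (1 / (1 - w/2)) - 2 = Moebius_function 0 (1/2) w"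
    by (simp add: Moebius_function_simple field_simps)
  moreover have "3/2 * (w/2) ^ m - (if m = 0 then 2 else 0) = (3/2 * (1/2) ^ m - (if m = 0 then 2 else 0)) * w ^ m" for m
    by (simp add: power_divide left_diff_distrib)
  ultimately show ?thesis by simp
qed

section \<open>Testing functionals on monomials and on automorphisms\<close>

text \<open>Taylor partial sums converge locally uniformly, so polynomials are dense.\<close>

lemma hol_functional_eq_zero:
  assumes \<Lambda>: "linear_functional_on hol_disc \<Lambda>" "continuous_map hol_topology euclidean (\<Lambda> :: _ \<Rightarrow> complex)"
    and mon: "\<And>n. \<Lambda> (comp_disc (\<lambda>w. w ^ n) (\<lambda>z. z)) = 0"
    and f: "f \<in> hol_disc"
  shows "\<Lambda> f = 0"
proof -
  define b where "b m = (deriv ^^ m) f 0 / fact m" for m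
  have sums: "(\<lambda>m. b m * w ^ m) sums f w" if "w \<in> disc" for w
    using holomorphic_power_series[of f 0 1 w] f that by (simp add: b_def hol_disc_def)
  define p where "p n = comp_disc (\<lambda>w. w ^ n) (\<lambda>z. z)" for n
  define v where "v N = (\<lambda>z. \<Sum>m<N. b m * p m z)" for N
  have p: "p n \<in> hol_disc" for n
    unfolding p_def by (intro comp_disc_in_hol_disc holomorphic_intros) auto
  have v: "v N \<in> hol_disc" "\<Lambda> (v N) = (\<Sum>m<N. b m * \<Lambda> (p m))" for N
    using linear_functional_on_sum[OF linear_space_hol_disc \<Lambda>(1), of "{..<N}" p] p
    by (auto simp: v_def)
  have "uniform_limit K v f sequentially" if K: "compact K" "K \<subseteq> disc" for K
  proof -
    \<comment> \<open>Truncation is the multiplier sequence whose limit is constantly 1.\<close>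
    define c :: "nat \<Rightarrow> nat \<Rightarrow> complex" where "c N m = (if m < N then 1 else 0)" for N m
    have "uniform_limit K (\<lambda>N w. \<Sum>m. c N m * (b m * w ^ m)) (\<lambda>w. \<Sum>m. 1 * (b m * w ^ m)) sequentially"
      using sums K by (intro power_series_multiplier_limit) (auto simp: c_def sums_iff)
    moreover have "(\<Sum>m. c N m * (b m * w ^ m)) = v N w" if "w \<in> K" for N w
      using that K suminf_finite[of "{..<N}" "\<lambda>m. c N m * (b m * w ^ m)"]
      by (auto simp: c_def v_def p_def comp_disc_def subset_iff)
    moreover have "(\<Sum>m. 1 * (b m * w ^ m)) = f w" if "w \<in> K" for w
      using sums[of w] that K by (auto simp: sums_iff)
    ultimately show ?thesis
      by (simp cong: uniform_limit_cong')
  qed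
  then have "(\<lambda>N. \<Lambda> (v N)) \<longlonglongrightarrow> \<Lambda> f"
    by (rule hol_functional_tendsto[OF \<Lambda>(2) v(1) f])
  then show ?thesis
    using mon by (simp add: v(2) p_def LIMSEQ_const_iff)
qed

text \<open>A Moebius map preceded by a rotation is again an automorphism. If
  \<open>\<Lambda>\<close> vanished on all of these, each Taylor term of the map would be killed
  too, and with nonzero coefficients so would every monomial.\<close>

lemma hol_functional_nonzero_on_Aut_disc:
  assumes \<Lambda>: "linear_functional_on hol_disc \<Lambda>" "continuous_map hol_topology euclidean (\<Lambda> :: _ \<Rightarrow> complex)"
    and f: "f \<in> hol_disc" "\<Lambda> f \<noteq> 0"
  obtains \<phi> where "\<phi> \<in> Aut_disc" "\<Lambda> (comp_disc (\<lambda>w. w) \<phi>) \<noteq> 0"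
proof -
  have False if *: "\<forall>\<phi>\<in>Aut_disc. \<Lambda> (comp_disc (\<lambda>w. w) \<phi>) = 0"
  proof -
    define h where "h = Moebius_function 0 (1/2)"
    define a :: "nat \<Rightarrow> complex" where "a m = 3/2 * (1/2) ^ m - (if m = 0 then 2 else 0)" for m
    have h: "h \<in> Aut_disc" unfolding h_def by (intro Moebius_function_in_Aut_disc) simp
    have "\<Lambda> (comp_disc h (\<lambda>z. c * z)) = 0" if "cmod c = 1" for c
    proof -
      have "comp_disc h (\<lambda>z. c * z) = comp_disc (\<lambda>w. w) (\<lambda>z. h (c * z))"
        by (simp add: comp_disc_def)
      with * Aut_disc_compose[OF h rotation_in_Aut_disc[OF that]] show ?thesis by simp
    qed
    \<comment> \<open>The coefficient bound is applied with \<open>M = 0\<close> and the identity as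
      inner map.\<close>
    then have "cmod (a n) * cmod (\<Lambda> (comp_disc (\<lambda>w. w ^ n) (\<lambda>z. z))) \<le> 0" for n
      using Moebius_half_sums Aut_discD[OF h]
      by (intro hol_functional_coefficient_bound[OF \<Lambda>, of h]) (auto simp: a_def h_def)
    moreover have "a n \<noteq> 0" for n by (simp add: a_def)
    ultimately have "\<Lambda> (comp_disc (\<lambda>w. w ^ n) (\<lambda>z. z)) = 0" for n
      by (metis mult_le_0_iff norm_le_zero_iff zero_less_norm_iff not_le)
    from hol_functional_eq_zero[OF \<Lambda> this f(1)] f(2) show False by simp
  qed
  then show thesis using that by blast
qed

section \<open>Seminorm bounds for the derivative at 0\<close>

text \<open>For an automorphism \<open>\<phi>\<close> with \<open>\<Lambda>\<close> nonzero at
  \<open>\<phi>\<close>, the maps \<open>c * \<phi> z\<close> with \<open>cmod c = 1\<close> are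
  automorphisms, so invariance bounds \<open>\<Lambda>\<close> on all compositions with them at
  once. The coefficient bound for \<open>n = 1\<close> then controls the derivative.\<close>

lemma moebius_invariant_deriv_bound:
  assumes Y: "moebius_invariant Y \<rho>" and L: "\<exists>f\<in>Y. L f \<noteq> 0" "decent Y L" "continuous_functional Y \<rho> L"
  obtains C where "\<And>h. h \<in> Y \<Longrightarrow> cmod (deriv h 0) \<le> C * \<rho> h"
proof -
  obtain \<Lambda> where \<Lambda>: "linear_functional_on hol_disc \<Lambda>" "continuous_map hol_topology euclidean \<Lambda>"
      "\<And>f. f \<in> Y \<Longrightarrow> \<Lambda> f = L f"
    using L(2) unfolding decent_def by blast
  obtain f where f: "f \<in> Y" "L f \<noteq> 0" using L(1) by blast
  have hol: "h \<in> hol_disc" if "h \<in> Y" for h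
    using that Y by (auto simp: moebius_invariant_def)
  obtain \<phi> where \<phi>: "\<phi> \<in> Aut_disc" "\<Lambda> (comp_disc (\<lambda>w. w) \<phi>) \<noteq> 0"
    using hol_functional_nonzero_on_Aut_disc[OF \<Lambda>(1,2) hol[OF f(1)]] f \<Lambda>(3) by auto
  obtain B where B: "\<And>h. h \<in> Y \<Longrightarrow> cmod (L h) \<le> B * \<rho> h"
    using L(3) unfolding continuous_functional_def by blast
  obtain K where K: "K > 0" "\<And>h \<phi>. h \<in> Y \<Longrightarrow> \<phi> \<in> Aut_disc \<Longrightarrow> \<rho> (comp_disc h \<phi>) \<le> K * \<rho> h"
    using Y unfolding moebius_invariant_def by blast
  have comp: "comp_disc h \<phi> \<in> Y" if "h \<in> Y" "\<phi> \<in> Aut_disc" for h \<phi>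
    using Y that unfolding moebius_invariant_def by blast
  have pos: "0 \<le> \<rho> h" if "h \<in> Y" for h
    using Y that unfolding moebius_invariant_def seminorm_on_def by blast
  define l where "l = cmod (\<Lambda> (comp_disc (\<lambda>w. w) \<phi>))"
  \<comment> \<open>The absolute value is taken because \<open>B\<close> carries no sign;
    monotonicity needs a nonnegative factor.\<close>
  have "cmod (deriv h 0) \<le> \<bar>B\<bar> * K / l * \<rho> h" if h: "h \<in> Y" for h
  proof -
    have "cmod (\<Lambda> (comp_disc h (\<lambda>z. c * \<phi> z))) \<le> \<bar>B\<bar> * K * \<rho> h" if c: "cmod c = 1" for c
    proof -
      have A: "(\<lambda>z. c * \<phi> z) \<in> Aut_disc"
        using Aut_disc_compose[OF rotation_in_Aut_disc[OF c] \<phi>(1)] .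
      have "cmod (\<Lambda> (comp_disc h (\<lambda>z. c * \<phi> z))) \<le> B * \<rho> (comp_disc h (\<lambda>z. c * \<phi> z))"
        using B[OF comp[OF h A]] \<Lambda>(3)[OF comp[OF h A]] by simp
      also have "\<dots> \<le> \<bar>B\<bar> * \<rho> (comp_disc h (\<lambda>z. c * \<phi> z))"
        by (intro mult_right_mono pos comp h A) simp
      also have "\<dots> \<le> \<bar>B\<bar> * (K * \<rho> h)"
        by (intro mult_left_mono K h A) simp
      finally show ?thesis by (simp add: mult_ac)
    qed
    moreover have "(\<lambda>m. (deriv ^^ m) h 0 / fact m * w ^ m) sums h w" if "w \<in> disc" for w
      using holomorphic_power_series[of h 0 1 w] hol[OF h] that by (simp add: hol_disc_def)
    ultimately have "cmod ((deriv ^^ 1) h 0 / fact 1) * cmod (\<Lambda> (comp_disc (\<lambda>w. w ^ 1) \<phi>)) \<le> \<bar>B\<bar> * K * \<rho> h"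
      using hol[OF h] Aut_discD[OF \<phi>(1)] by (intro hol_functional_coefficient_bound[OF \<Lambda>(1,2), of h]) (auto simp: hol_disc_def)
    then show ?thesis using \<phi>(2) by (simp add: l_def field_simps)
  qed
  then show thesis by (rule that)
qed

text \<open>Invariance of \<open>X\<close> handles the inner composition, invariance of
  \<open>Y\<close> the outer one. The constant is independent of both automorphisms, which later
  lets the point \<open>\<psi> 0\<close> range over the whole disc.\<close>

lemma operator_deriv_bound:
  assumes X: "moebius_invariant X \<rho>X" and Y: "moebius_invariant Y \<rho>Y"
    and L: "\<exists>f\<in>Y. L f \<noteq> 0" "decent Y L" "continuous_functional Y \<rho>Y L"
    and T: "continuous_operator X \<rho>X Y \<rho>Y T"
  obtains C where "\<And>F \<phi> \<psi>. F \<in> X \<Longrightarrow> \<phi> \<in> Aut_disc \<Longrightarrow> \<psi> \<in> Aut_disc \<Longrightarrow>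
      cmod (deriv (comp_disc (T (comp_disc F \<phi>)) \<psi>) 0) \<le> C * \<rho>X F"
proof -
  obtain D where D: "\<And>h. h \<in> Y \<Longrightarrow> cmod (deriv h 0) \<le> D * \<rho>Y h"
    using moebius_invariant_deriv_bound[OF Y L] by blast
  obtain KX where KX: "KX > 0" "\<And>h \<phi>. h \<in> X \<Longrightarrow> \<phi> \<in> Aut_disc \<Longrightarrow> \<rho>X (comp_disc h \<phi>) \<le> KX * \<rho>X h"
    using X unfolding moebius_invariant_def by blast
  obtain KY where KY: "KY > 0" "\<And>h \<phi>. h \<in> Y \<Longrightarrow> \<phi> \<in> Aut_disc \<Longrightarrow> \<rho>Y (comp_disc h \<phi>) \<le> KY * \<rho>Y h"
    using Y unfolding moebius_invariant_def by blast
  obtain B where B: "\<And>f. f \<in> X \<Longrightarrow> \<rho>Y (T f) \<le> B * \<rho>X f" and T_in: "\<And>f. f \<in> X \<Longrightarrow> T f \<in> Y"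
    using T unfolding continuous_operator_def by blast
  have compX: "comp_disc h \<phi> \<in> X" if "h \<in> X" "\<phi> \<in> Aut_disc" for h \<phi>
    using X that unfolding moebius_invariant_def by blast
  have compY: "comp_disc h \<phi> \<in> Y" if "h \<in> Y" "\<phi> \<in> Aut_disc" for h \<phi>
    using Y that unfolding moebius_invariant_def by blast
  have posX: "0 \<le> \<rho>X h" if "h \<in> X" for h
    using X that unfolding moebius_invariant_def seminorm_on_def by blast
  have posY: "0 \<le> \<rho>Y h" if "h \<in> Y" for h
    using Y that unfolding moebius_invariant_def seminorm_on_def by blast
  show thesis
  proof (rule that)
    fix F \<phi> \<psi> assume F: "F \<in> X" and \<phi>: "\<phi> \<in> Aut_disc" and \<psi>: "\<psi> \<in> Aut_disc"
    let ?f = "comp_disc F \<phi>"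
    have f: "?f \<in> X" and Tf: "T ?f \<in> Y" and h: "comp_disc (T ?f) \<psi> \<in> Y"
      by (simp_all add: compX compY T_in F \<phi> \<psi>)
    have "cmod (deriv (comp_disc (T ?f) \<psi>) 0) \<le> D * \<rho>Y (comp_disc (T ?f) \<psi>)"
      by (rule D[OF h])
    also have "\<dots> \<le> \<bar>D\<bar> * \<rho>Y (comp_disc (T ?f) \<psi>)"
      by (intro mult_right_mono posY h) simp
    also have "\<dots> \<le> \<bar>D\<bar> * (KY * \<rho>Y (T ?f))"
      by (intro mult_left_mono KY Tf \<psi>) simp
    also have "\<dots> \<le> \<bar>D\<bar> * (KY * (B * \<rho>X ?f))"
      using KY(1) by (intro mult_left_mono B f) simp_all
    also have "\<dots> \<le> \<bar>D\<bar> * (KY * (\<bar>B\<bar> * \<rho>X ?f))"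
      using KY(1) by (intro mult_left_mono mult_right_mono posX f) simp_all
    also have "\<dots> \<le> \<bar>D\<bar> * (KY * (\<bar>B\<bar> * (KX * \<rho>X F)))"
      using KY(1) by (intro mult_left_mono KX F \<phi>) simp_all
    finally show "cmod (deriv (comp_disc (T ?f) \<psi>) 0) \<le> (\<bar>D\<bar> * KY * \<bar>B\<bar> * KX) * \<rho>X F"
      by (simp add: mult_ac)
  qed
qed

section \<open>Derivatives at 0 of conjugated operators\<close>

lemma comp_disc_has_field_derivative:
  assumes f: "(f has_field_derivative f') (at (\<psi> z))" and \<psi>: "\<psi> \<in> Aut_disc" and z: "z \<in> disc"
  shows "(comp_disc f \<psi> has_field_derivative f' * deriv \<psi> z) (at z)"
proof -
  have "(\<psi> has_field_derivative deriv \<psi> z) (at z)"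
    using Aut_discD(1)[OF \<psi>] z by (intro holomorphic_derivI[of \<psi> disc]) auto
  from DERIV_chain[OF f this] show ?thesis
    by (rule has_field_derivative_transform_within_open[of _ _ _ disc]) (use z in \<open>auto simp: comp_disc_def\<close>)
qed

text \<open>A nonconstant function has nonzero derivative at some point, and an automorphism moves
  that point to 0.\<close>

lemma nonzero_deriv_at_0:
  assumes X: "moebius_invariant X \<rho>X" and f: "f \<in> X" "\<not> f constant_on disc"
  obtains F where "F \<in> X" "deriv F 0 \<noteq> 0"
proof -
  have hol: "f holomorphic_on disc"
    using X f(1) by (auto simp: moebius_invariant_def hol_disc_def)
  then have der: "(f has_field_derivative deriv f p) (at p)" if "p \<in> disc" for p
    using that by (intro holomorphic_derivI[of f disc]) auto
  obtain p where p: "p \<in> disc" "deriv f p \<noteq> 0"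
  proof -
    have "f constant_on disc" if "\<forall>p\<in>disc. deriv f p = 0"
      using DERIV_zero_connected_constant_on[of disc "{}" f] der that
        holomorphic_on_imp_continuous_on[OF hol] by (auto simp: convex_connected)
    then show thesis using f(2) that by blast
  qed
  obtain \<psi> \<eta> where \<psi>: "\<psi> \<in> Aut_disc" "\<eta> \<in> Aut_disc" "\<psi> 0 = p" "\<And>z. z \<in> disc \<Longrightarrow> \<eta> (\<psi> z) = z"
    using Aut_disc_transitive[OF p(1)] by blast
  have "(comp_disc \<eta> \<psi> has_field_derivative deriv \<eta> p * deriv \<psi> 0) (at 0)"
    using Aut_discD(1)[OF \<psi>(2)] \<psi>(1,3) p(1)
    by (intro comp_disc_has_field_derivative) (auto intro!: holomorphic_derivI[of \<eta> disc])
  moreover have "(comp_disc \<eta> \<psi> has_field_derivative 1) (at 0)"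
    by (rule has_field_derivative_transform_within_open[of "\<lambda>z. z" _ _ disc])
       (use \<psi>(4) in \<open>auto simp: comp_disc_def\<close>)
  \<comment> \<open>The chain rule for the left inverse shows that \<open>\<psi>\<close> has nonzero
    derivative at 0.\<close>
  ultimately have "deriv \<eta> p * deriv \<psi> 0 = 1"
    by (rule DERIV_unique)
  then have "deriv \<psi> 0 \<noteq> 0" by auto
  moreover have "deriv (comp_disc f \<psi>) 0 = deriv f p * deriv \<psi> 0"
    using der[OF p(1)] \<psi>(1,3) by (intro DERIV_imp_deriv comp_disc_has_field_derivative) auto
  moreover have "comp_disc f \<psi> \<in> X"
    using X f(1) \<psi>(1) unfolding moebius_invariant_def by blast
  ultimately show thesis using p(2) that by auto
qed

text \<open>On the convex disc the integrand has a primitive \<open>P\<close>, and the integral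
  along the segment from 0 is \<open>P x - P 0\<close>.\<close>

lemma int_op_has_field_derivative:
  assumes g: "g holomorphic_on disc" and f: "f holomorphic_on disc" and z: "z \<in> disc"
  shows "(int_op g f has_field_derivative g z * deriv f z) (at z)"
proof -
  have "(\<lambda>\<xi>. g \<xi> * deriv f \<xi>) holomorphic_on disc"
    using g f by (intro holomorphic_intros holomorphic_deriv) auto
  then obtain P where P: "\<And>x. x \<in> disc \<Longrightarrow> (P has_field_derivative g x * deriv f x) (at x within disc)"
    using holomorphic_convex_primitive'[of disc] by auto
  have eq: "P x - P 0 = int_op g f x" if "x \<in> disc" for x
  proof -
    have "closed_segment 0 x \<subseteq> disc"
      using that by (intro closed_segment_subset) auto
    then have "((\<lambda>\<xi>. g \<xi> * deriv f \<xi>) has_contour_integral P x - P 0) (linepath 0 x)"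
      using contour_integral_primitive[OF P, of "linepath 0 x"] by simp
    then show ?thesis using that by (simp add: int_op_def contour_integral_unique)
  qed
  have "(P has_field_derivative g z * deriv f z) (at z)"
    using P[OF z] by (simp only: at_within_open[OF z open_ball])
  then have "((\<lambda>x. P x - P 0) has_field_derivative g z * deriv f z) (at z)"
    using DERIV_diff[OF _ DERIV_const] by fastforce
  then show ?thesis
    by (rule has_field_derivative_transform_within_open[OF _ open_ball z eq])
qed

text \<open>Conjugation turns multiplication by \<open>g\<close> into multiplication of
  \<open>F\<close> by \<open>comp_disc g \<psi>\<close>; the product rule at 0 gives the two
  summands.\<close>

lemma deriv_conjugated_mult_op:
  assumes g: "g holomorphic_on disc" and F: "F holomorphic_on disc"
    and \<psi>: "\<psi> \<in> Aut_disc" and inv: "\<And>z. z \<in> disc \<Longrightarrow> \<eta> (\<psi> z) = z"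
  shows "deriv (comp_disc (mult_op g (comp_disc F \<eta>)) \<psi>) 0
    = deriv g (\<psi> 0) * deriv \<psi> 0 * F 0 + g (\<psi> 0) * deriv F 0"
proof (rule DERIV_imp_deriv)
  have \<psi>0: "\<psi> 0 \<in> disc" using Aut_discD(3)[OF \<psi>] by simp
  have "(comp_disc g \<psi> has_field_derivative deriv g (\<psi> 0) * deriv \<psi> 0) (at 0)"
    using g \<psi> \<psi>0 by (intro comp_disc_has_field_derivative holomorphic_derivI[of g disc]) auto
  moreover have "(F has_field_derivative deriv F 0) (at 0)"
    using F by (intro holomorphic_derivI[of F disc]) auto
  ultimately have "((\<lambda>z. comp_disc g \<psi> z * F z) has_field_derivative
      deriv g (\<psi> 0) * deriv \<psi> 0 * F 0 + deriv F 0 * comp_disc g \<psi> 0) (at 0)"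
    by (rule DERIV_mult)
  then have "((\<lambda>z. comp_disc g \<psi> z * F z) has_field_derivative
      deriv g (\<psi> 0) * deriv \<psi> 0 * F 0 + g (\<psi> 0) * deriv F 0) (at 0)"
    by (simp add: comp_disc_def mult.commute[of "deriv F 0"])
  then show "(comp_disc (mult_op g (comp_disc F \<eta>)) \<psi> has_field_derivative
      deriv g (\<psi> 0) * deriv \<psi> 0 * F 0 + g (\<psi> 0) * deriv F 0) (at 0)"
    by (rule has_field_derivative_transform_within_open[of _ _ _ disc])
       (use inv Aut_discD(3)[OF \<psi>] in \<open>auto simp: comp_disc_def mult_op_def\<close>)
qed

text \<open>The factor \<open>deriv \<psi> 0\<close> from the outer composition combines with the
  derivative of \<open>comp_disc F \<eta>\<close> to that of \<open>F\<close>, since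
  \<open>\<eta>\<close> undoes \<open>\<psi>\<close>.\<close>

lemma deriv_conjugated_int_op:
  assumes g: "g holomorphic_on disc" and F: "F holomorphic_on disc"
    and \<psi>: "\<psi> \<in> Aut_disc" and \<eta>: "\<eta> \<in> Aut_disc" and inv: "\<And>z. z \<in> disc \<Longrightarrow> \<eta> (\<psi> z) = z"
  shows "deriv (comp_disc (int_op g (comp_disc F \<eta>)) \<psi>) 0 = g (\<psi> 0) * deriv F 0"
proof -
  have \<psi>0: "\<psi> 0 \<in> disc" using Aut_discD(3)[OF \<psi>] by simp
  let ?f = "comp_disc F \<eta>"
  have f: "?f holomorphic_on disc"
    using comp_disc_in_hol_disc[OF F Aut_discD(1,2)[OF \<eta>]] by (simp add: hol_disc_def)
  have "deriv (comp_disc (int_op g ?f) \<psi>) 0 = g (\<psi> 0) * deriv ?f (\<psi> 0) * deriv \<psi> 0"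
    using g f \<psi> \<psi>0 by (intro DERIV_imp_deriv comp_disc_has_field_derivative int_op_has_field_derivative) auto
  moreover have "(comp_disc ?f \<psi> has_field_derivative deriv ?f (\<psi> 0) * deriv \<psi> 0) (at 0)"
    using f \<psi> \<psi>0 by (intro comp_disc_has_field_derivative holomorphic_derivI[of ?f disc]) auto
  then have "(F has_field_derivative deriv ?f (\<psi> 0) * deriv \<psi> 0) (at 0)"
    by (rule has_field_derivative_transform_within_open[of _ _ _ disc])
       (use inv Aut_discD(3)[OF \<psi>] in \<open>auto simp: comp_disc_def\<close>)
  then have "deriv F 0 = deriv ?f (\<psi> 0) * deriv \<psi> 0"
    by (rule DERIV_imp_deriv)
  ultimately show ?thesis by (simp add: mult_ac)
qed

section \<open>Boundedness of the symbol\<close>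

lemma H_inf_if_multiple_bounded:
  assumes "g \<in> hol_disc" "d \<noteq> 0" "\<And>w. w \<in> disc \<Longrightarrow> cmod (g w * d) \<le> B"
  shows "g \<in> H_inf"
proof -
  have "cmod (g w) \<le> B / cmod d" if "w \<in> disc" for w
    using assms(3)[OF that] assms(2) by (simp add: norm_mult field_simps)
  then show ?thesis
    using assms(1) unfolding H_inf_def bounded_iff by blast
qed

theorem proposition1p1:
  fixes X Y :: "(complex \<Rightarrow> complex) set"
    and \<rho>X \<rho>Y :: "(complex \<Rightarrow> complex) \<Rightarrow> real"
    and g :: "complex \<Rightarrow> complex"
  assumes "moebius_invariant X \<rho>X"
    and "moebius_invariant Y \<rho>Y"
    and "\<exists>f\<in>X. \<not> f constant_on disc"
    and "\<exists>L. linear_functional_on Y L \<and> (\<exists>f\<in>Y. L f \<noteq> 0) \<and> decent Y L \<and>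
             continuous_functional Y \<rho>Y L"
    and "g \<in> hol_disc"
  shows "(continuous_operator X \<rho>X Y \<rho>Y (mult_op g) \<longrightarrow> g \<in> H_inf) \<and>
         (continuous_operator X \<rho>X Y \<rho>Y (int_op g) \<longrightarrow> g \<in> H_inf)"
proof -
  obtain L where L: "\<exists>f\<in>Y. L f \<noteq> 0" "decent Y L" "continuous_functional Y \<rho>Y L"
    using assms(4) by blast
  obtain F where F: "F \<in> X" "deriv F 0 \<noteq> 0"
    using assms(3) nonzero_deriv_at_0[OF assms(1)] by blast
  have holF: "F holomorphic_on disc" and holg: "g holomorphic_on disc"
    using F(1) assms(1,5) by (auto simp: moebius_invariant_def hol_disc_def)
  show ?thesis
  proof (intro conjI impI)
    assume "continuous_operator X \<rho>X Y \<rho>Y (mult_op g)"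
    from operator_deriv_bound[OF assms(1,2) L this] obtain C where
      C: "\<And>F \<phi> \<psi>. F \<in> X \<Longrightarrow> \<phi> \<in> Aut_disc \<Longrightarrow> \<psi> \<in> Aut_disc \<Longrightarrow>
        cmod (deriv (comp_disc (mult_op g (comp_disc F \<phi>)) \<psi>) 0) \<le> C * \<rho>X F"
      by blast
    show "g \<in> H_inf"
    proof (rule H_inf_if_multiple_bounded[OF assms(5) F(2)])
      fix w assume "w \<in> disc"
      then obtain \<psi> \<eta> where \<psi>: "\<psi> \<in> Aut_disc" "\<eta> \<in> Aut_disc" "\<psi> 0 = w"
          "\<And>z. z \<in> disc \<Longrightarrow> \<eta> (\<psi> z) = z"
        using Aut_disc_transitive by blast
      \<comment> \<open>The second pair still sends 0 to \<open>w\<close> and \<open>\<eta>'\<close>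
        still undoes \<open>\<psi>'\<close>, but the derivative at 0 changes sign.\<close>
      define \<psi>' \<eta>' where "\<psi>' = (\<lambda>z. \<psi> (- z))" and "\<eta>' = (\<lambda>z. - \<eta> z)"
      have A: "\<psi>' \<in> Aut_disc" "\<eta>' \<in> Aut_disc"
        using Aut_disc_compose[OF \<psi>(1) rotation_in_Aut_disc[of "-1"]]
          Aut_disc_compose[OF rotation_in_Aut_disc[of "-1"] \<psi>(2)] by (simp_all add: \<psi>'_def \<eta>'_def)
      have "(\<psi> has_field_derivative deriv \<psi> 0) (at (- 0))"
        using Aut_discD(1)[OF \<psi>(1)] by (auto intro!: holomorphic_derivI[of \<psi> disc])
      moreover have "(uminus has_field_derivative - 1) (at (0::complex))"
        by (auto intro!: derivative_eq_intros)
      ultimately have "(\<psi>' has_field_derivative deriv \<psi> 0 * - 1) (at 0)"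
        unfolding \<psi>'_def by (rule DERIV_chain2)
      then have "deriv \<psi>' 0 = - deriv \<psi> 0"
        using DERIV_imp_deriv by fastforce
      \<comment> \<open>The summands containing \<open>deriv g w * F 0\<close> are opposite and
        cancel, while those with \<open>g w\<close> agree.\<close>
      then have "2 * (g w * deriv F 0) = deriv (comp_disc (mult_op g (comp_disc F \<eta>)) \<psi>) 0
          + deriv (comp_disc (mult_op g (comp_disc F \<eta>')) \<psi>') 0"
        using deriv_conjugated_mult_op[OF holg holF \<psi>(1), of \<eta>]
          deriv_conjugated_mult_op[OF holg holF A(1), of \<eta>'] \<psi>(3,4)
        by (simp add: \<psi>'_def \<eta>'_def)
      then have "cmod (2 * (g w * deriv F 0)) \<le> C * \<rho>X F + C * \<rho>X F"
        using C[OF F(1) \<psi>(2,1)] C[OF F(1) A(2,1)] by (simp only: norm_triangle_mono)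
      then show "cmod (g w * deriv F 0) \<le> C * \<rho>X F"
        by (simp add: norm_mult)
    qed
  next
    assume "continuous_operator X \<rho>X Y \<rho>Y (int_op g)"
    from operator_deriv_bound[OF assms(1,2) L this] obtain C where
      C: "\<And>F \<phi> \<psi>. F \<in> X \<Longrightarrow> \<phi> \<in> Aut_disc \<Longrightarrow> \<psi> \<in> Aut_disc \<Longrightarrow>
        cmod (deriv (comp_disc (int_op g (comp_disc F \<phi>)) \<psi>) 0) \<le> C * \<rho>X F"
      by blast
    show "g \<in> H_inf"
    proof (rule H_inf_if_multiple_bounded[OF assms(5) F(2)])
      fix w assume "w \<in> disc"
      then obtain \<psi> \<eta> where \<psi>: "\<psi> \<in> Aut_disc" "\<eta> \<in> Aut_disc" "\<psi> 0 = w"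
          "\<And>z. z \<in> disc \<Longrightarrow> \<eta> (\<psi> z) = z"
        using Aut_disc_transitive by blast
      then show "cmod (g w * deriv F 0) \<le> C * \<rho>X F"
        using C[OF F(1) \<psi>(2,1)] deriv_conjugated_int_op[OF holg holF \<psi>(1,2,4)] by simp
    qed
  qed
qed

end
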